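(* Let $X$ be a separable Banach space, let $N_d,K$ be positive integers, $\nu>0$, $\pi_1,\dots,\pi_K\in(0,1)$ with $\sum_{k=1}^K\pi_k=1$, $\zeta_1,\dots,\zeta_K\in\mathbb{C}^{N_d}$, and let $\Sigma_1,\dots,\Sigma_K$ be positive definite Hermitian $N_d\times N_d$ matrices. Let $\mathcal{F}_a:X\to\mathbb{C}^{N_d}$ be a Fréchet differentiable map such that: (1) for every $\epsilon>0$ there are $M=M(\epsilon)\in\mathbb{R}$ and $C\in\mathbb{R}$ such that $\|\mathcal{F}_a(m)\|_2\le C\exp(\epsilon\|m\|_X^2+M)$ for all $m\in X$; (2) for every $\rho>0$ there is a constant $K_\rho>0$ such that $\|\mathcal{F}_a'(m)\|_{op}\le K_\rho$ for all $m\in X$ with $\|m\|_X<\rho$. Let $\mu_0$ be a Borel measure on $X$ with $\mu_0(X)=1$, such that $\mu_0(X\cap B)>0$ for some bounded set $B$ in $X$, and such that $\int_X\exp(2\epsilon\|m\|_X^2)\,\mu_0(dm)<\infty$ for some $\epsilon>0$. For $m\in X$ and $d\in\mathbb{C}^{N_d}$ put $$\Phi(m;d)=\ln\Big\{\sum_{k=1}^K\pi_k\frac{1}{\pi^{N_d}\det(\Sigma_k+\nu I)}\exp\big(-\|d-\mathcal{F}_a(m)-\zeta_k\|^2_{\Sigma_k+\nu I}\big)\Big\},\qquad Z(d)=\int_X\exp(\Phi(m;d))\,\mu_0(dm).$$ Then for every $d\in\mathbb{C}^{N_d}$, $Z(d)$ is positive and the probability measure $\mu^d$ on $X$ given by $$\frac{d\mu^d}{d\mu_0}(m)=\frac{1}{Z(d)}\exp(\Phi(m;d))$$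 is well-defined. In addition, for every $r>0$ there is $C=C(r)>0$ such that for all $d_1,d_2\in B(0,r)\subset\mathbb{C}^{N_d}$, $$d_{\mathrm{Hell}}(\mu^{d_1},\mu^{d_2})\le C\|d_1-d_2\|_2 .$$
   Context: For a positive definite Hermitian matrix $\Gamma$ and $v\in\mathbb{C}^{N_d}$, $\|v\|_\Gamma^2:=v^H\Gamma^{-1}v$, where $v^H$ is the conjugate transpose. $\|\cdot\|_2$ is the Euclidean ($\ell^2$) norm, $I$ is the identity matrix, and in $\pi^{N_d}$ the symbol $\pi$ is the number $3.14\ldots$ (while $\pi_k$ are the mixture weights). $\mathcal{F}_a'(m)$ is the Fréchet derivative and $\|\cdot\|_{op}$ the operator norm. $B(0,r)$ is the ball with centre $0$ and radius $r$. $d_{\mathrm{Hell}}$ is the Hellinger distance: for probability measures $\mu,\mu'$ absolutely continuous with respect to $\mu_0$, $d_{\mathrm{Hell}}(\mu,\mu')^2=\frac12\int_X\big(\sqrt{d\mu/d\mu_0}-\sqrt{d\mu'/d\mu_0}\big)^2d\mu_0$. The constant $C(r)$ may depend on all the fixed data ($\mu_0$, $\mathcal{F}_a$, the mixture parameters), but not on $d_1,d_2$. *)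

theory Defs
  imports "HOL-Probability.Probability"
begin

definition conj_transpose :: "complex^'n^'m \<Rightarrow> complex^'m^'n" where
  "conj_transpose A = (\<chi> i j. cnj (A $ j $ i))"

definition hermitian :: "complex^'n^'n \<Rightarrow> bool" where
  "hermitian A \<longleftrightarrow> conj_transpose A = A"

(* v^H w *)
definition cdot :: "complex^'n \<Rightarrow> complex^'n \<Rightarrow> complex" where
  "cdot v w = (\<Sum>i\<in>UNIV. cnj (v $ i) * w $ i)"

definition pos_def_hermitian :: "complex^'n^'n \<Rightarrow> bool" where
  "pos_def_hermitian A \<longleftrightarrow> hermitian A \<and> (\<forall>v. v \<noteq> 0 \<longrightarrow> 0 < Re (cdot v (A *v v)))"

(* The squared norm v^H G^(-1) v. For positive definite Hermitian G the argument of Re is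
   real (wnorm_sq_complex below), so Re only changes the type. *)
definition wnorm_sq :: "complex^'n^'n \<Rightarrow> complex^'n \<Rightarrow> real" where
  "wnorm_sq G v = Re (cdot v (matrix_inv G *v v))"

(* The determinant of a Hermitian matrix is real (det_hermitian_real below); again Re only
   changes the type. *)
definition Phi ::
  "real \<Rightarrow> nat \<Rightarrow> (nat \<Rightarrow> real) \<Rightarrow> (nat \<Rightarrow> complex^'n) \<Rightarrow> (nat \<Rightarrow> complex^'n^'n)
   \<Rightarrow> ('x \<Rightarrow> complex^'n) \<Rightarrow> 'x \<Rightarrow> complex^'n \<Rightarrow> real" where
  "Phi \<nu> K p \<zeta> \<Sigma> F m d =
     ln (\<Sum>k = 1..K. p k * (1 / (pi ^ CARD('n) * Re (det (\<Sigma> k + \<nu> *\<^sub>R mat 1))))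
           * exp (- wnorm_sq (\<Sigma> k + \<nu> *\<^sub>R mat 1) (d - F m - \<zeta> k)))"

definition Z ::
  "'x measure \<Rightarrow> real \<Rightarrow> nat \<Rightarrow> (nat \<Rightarrow> real) \<Rightarrow> (nat \<Rightarrow> complex^'n) \<Rightarrow> (nat \<Rightarrow> complex^'n^'n)
   \<Rightarrow> ('x \<Rightarrow> complex^'n) \<Rightarrow> complex^'n \<Rightarrow> real" where
  "Z \<mu>0 \<nu> K p \<zeta> \<Sigma> F d = (LINT m|\<mu>0. exp (Phi \<nu> K p \<zeta> \<Sigma> F m d))"

definition posterior ::
  "'x measure \<Rightarrow> real \<Rightarrow> nat \<Rightarrow> (nat \<Rightarrow> real) \<Rightarrow> (nat \<Rightarrow> complex^'n) \<Rightarrow> (nat \<Rightarrow> complex^'n^'n)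
   \<Rightarrow> ('x \<Rightarrow> complex^'n) \<Rightarrow> complex^'n \<Rightarrow> 'x measure" where
  "posterior \<mu>0 \<nu> K p \<zeta> \<Sigma> F d =
     density \<mu>0 (\<lambda>m. ennreal (1 / Z \<mu>0 \<nu> K p \<zeta> \<Sigma> F d * exp (Phi \<nu> K p \<zeta> \<Sigma> F m d)))"

(* Meaningful for probability measures M, N absolutely continuous with respect to the
   sigma-finite measure L; the integrand is then integrable. *)
definition hellinger_dist :: "'x measure \<Rightarrow> 'x measure \<Rightarrow> 'x measure \<Rightarrow> real" where
  "hellinger_dist L M N =
     sqrt (1 / 2 * (LINT x|L. (sqrt (enn2real (RN_deriv L M x)) - sqrt (enn2real (RN_deriv L N x)))\<^sup>2))"

lemma conj_transpose_mult: "conj_transpose (A ** B) = conj_transpose B ** conj_transpose A"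
  by (simp add: conj_transpose_def matrix_matrix_mult_def vec_eq_iff mult.commute)

lemma conj_transpose_mat_1: "conj_transpose (mat 1) = mat 1"
  by (auto simp: conj_transpose_def mat_def vec_eq_iff)

lemma hermitian_form_real:
  assumes "hermitian A"
  shows "cdot v (A *v v) = of_real (Re (cdot v (A *v v)))"
proof -
  have e: "cnj (A $ i $ j) = A $ j $ i" for i j
    using assms by (simp add: hermitian_def conj_transpose_def vec_eq_iff)
  have "cnj (cdot v (A *v v)) = (\<Sum>i\<in>UNIV. \<Sum>j\<in>UNIV. v $ i * (A $ j $ i * cnj (v $ j)))"
    by (simp add: cdot_def matrix_vector_mult_def sum_distrib_left e)
  also have "\<dots> = (\<Sum>j\<in>UNIV. \<Sum>i\<in>UNIV. v $ i * (A $ j $ i * cnj (v $ j)))"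
    by (rule sum.swap)
  also have "\<dots> = cdot v (A *v v)"
    by (simp add: cdot_def matrix_vector_mult_def sum_distrib_left mult_ac)
  finally show ?thesis
    by (metis Reals_cnj_iff of_real_Re)
qed

lemma det_hermitian_real:
  assumes "hermitian A"
  shows "det A = of_real (Re (det A))"
proof -
  have e: "cnj (A $ i $ j) = A $ j $ i" for i j
    using assms by (simp add: hermitian_def conj_transpose_def vec_eq_iff)
  have "cnj (det A) = det (transpose A)"
    by (simp add: det_def transpose_def e)
  then show ?thesis
    by (metis Reals_cnj_iff of_real_Re det_transpose)
qed

lemma pos_def_hermitian_invertible:
  assumes "pos_def_hermitian A"
  shows "invertible A"
proof -
  have "v = 0" if "A *v v = 0" for v
    using assms that by (force simp: pos_def_hermitian_def cdot_def)
  then show ?thesis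
    by (simp add: invertible_left_inverse matrix_left_invertible_ker)
qed

lemma hermitian_matrix_inv:
  assumes "pos_def_hermitian A"
  shows "hermitian (matrix_inv A)"
proof -
  let ?B = "matrix_inv A"
  have h: "conj_transpose A = A"
    using assms by (simp add: pos_def_hermitian_def hermitian_def)
  have i: "A ** ?B = mat 1" "?B ** A = mat 1"
    using someI_ex[OF pos_def_hermitian_invertible[OF assms, unfolded invertible_def]]
    by (simp_all add: matrix_inv_def)
  have "conj_transpose ?B ** A = mat 1"
    using conj_transpose_mult[of A ?B] by (simp add: i h conj_transpose_mat_1)
  then have "conj_transpose ?B = ?B"
    using i by (metis matrix_mul_assoc matrix_mul_lid matrix_mul_rid)
  then show ?thesis by (simp add: hermitian_def)
qed

lemma wnorm_sq_complex:
  assumes "pos_def_hermitian G"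
  shows "cdot v (matrix_inv G *v v) = of_real (wnorm_sq G v)"
  unfolding wnorm_sq_def by (rule hermitian_form_real[OF hermitian_matrix_inv[OF assms]])

lemma pos_def_hermitian_shift:
  fixes A :: "complex^'n^'n" and c :: real
  assumes "pos_def_hermitian A" "0 \<le> c"
  shows "pos_def_hermitian (A + c *\<^sub>R mat 1)"
proof -
  have "hermitian (A + c *\<^sub>R mat 1)"
    using assms(1)
    by (auto simp: pos_def_hermitian_def hermitian_def conj_transpose_def vec_eq_iff mat_def)
  moreover have "0 < Re (cdot v ((A + c *\<^sub>R mat 1) *v v))" if "v \<noteq> 0" for v
  proof -
    have "((A + c *\<^sub>R mat 1) *v v) $ i = (A *v v) $ i + of_real c * v $ i" for i
    proof -
      have "((A + c *\<^sub>R mat 1) *v v) $ i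
          = (\<Sum>j\<in>UNIV. A $ i $ j * v $ j + (if j = i then of_real c * v $ i else 0))"
        unfolding matrix_vector_mult_def vec_lambda_beta
        by (rule sum.cong) (auto simp: mat_def scaleR_conv_of_real[where 'a = complex] distrib_right)
      also have "\<dots> = (A *v v) $ i + of_real c * v $ i"
        by (simp add: sum.distrib matrix_vector_mult_def)
      finally show ?thesis .
    qed
    then have "cdot v ((A + c *\<^sub>R mat 1) *v v) = cdot v (A *v v) + of_real c * cdot v v"
      by (simp add: cdot_def distrib_left sum.distrib sum_distrib_left mult.left_commute)
    moreover have "0 \<le> Re (cdot v v)"
      by (auto simp: cdot_def intro!: sum_nonneg)
    ultimately show ?thesis
      using assms that by (simp add: pos_def_hermitian_def add_pos_nonneg)
  qed
  ultimately show ?thesis by (simp add: pos_def_hermitian_def)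
qed

end

theory Submission
  imports Defs
begin

text \<open>
  Write $g_d(m) = \exp \Phi(m;d)$. This is a finite sum of terms
  $c_k \exp(-q_k(d - F(m) - \zeta_k))$ with $c_k > 0$ (a positive definite Hermitian matrix has a
  positive determinant) and $q_k$ a nonnegative quadratic form. So $0 < g_d(m) \le \sum_k c_k$, and
  since $F$ is continuous and $\mu_0$ is a probability measure, $g_d$ is integrable with a
  positive integral $Z(d)$; this makes $\mu^d$ well defined.

  The Lipschitz bound rests on the square root of $g_d$, which is what the Hellinger distance sees.
  For fixed $m$, $\sqrt{g_d(m)}$ is the $\ell^2$ norm of the vector with entries
  $\sqrt{c_k} \exp(-q_k/2)$. By the reverse triangle inequality it is Lipschitz in $d$ as soon as
  every entry is, and $\exp(-q/2)$ is Lipschitz because $\sqrt q$ is a seminorm and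
  $t \mapsto \exp(-t^2/2)$ has bounded slope. The data $d$ and the parameter $m$ enter only
  through $d - F(m)$, so one constant $L$ serves all $m$
  (\<open>sqrt_gaussian_mixture_lipschitz\<close>).

  It remains to pass from $g_d$ to the normalised densities. Expanding the square of the Hellinger
  distance in $L^2(\mu_0)$ bounds it by $L^2 \|d_1 - d_2\|^2 / (2 \sqrt{Z(d_1) Z(d_2)})$
  (\<open>hellinger_dist_normalised_density_le\<close>), and $Z$, being continuous and positive, is bounded
  below on the compact closed ball of radius $r$.
\<close>

section \<open>Hermitian forms and the determinant\<close>

lemma hermitian_cdot_adjoint:
  assumes "hermitian A"
  shows "cdot (A *v v) w = cdot v (A *v w)"
proof -
  have e: "cnj (A $ i $ j) = A $ j $ i" for i j
    using assms by (simp add: hermitian_def conj_transpose_def vec_eq_iff)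
  have "cdot (A *v v) w = (\<Sum>i\<in>UNIV. \<Sum>j\<in>UNIV. cnj (v $ j) * A $ j $ i * w $ i)"
    by (simp add: cdot_def matrix_vector_mult_def sum_distrib_right e mult.commute[of "A $ _ $ _"])
  also have "\<dots> = (\<Sum>j\<in>UNIV. \<Sum>i\<in>UNIV. cnj (v $ j) * A $ j $ i * w $ i)"
    by (rule sum.swap)
  also have "\<dots> = cdot v (A *v w)"
    by (simp add: cdot_def matrix_vector_mult_def sum_distrib_left mult_ac)
  finally show ?thesis .
qed

lemma Re_cdot_conv_inner: "Re (cdot v w) = inner v w"
  by (simp add: cdot_def inner_vec_def inner_complex_def)

lemma Re_cdot_matrix_commute:
  assumes "hermitian A"
  shows "Re (cdot v (A *v w)) = Re (cdot w (A *v v))"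
  by (metis assms hermitian_cdot_adjoint Re_cdot_conv_inner inner_commute)

lemma bounded_bilinear_Re_cdot_matrix:
  "bounded_bilinear (\<lambda>v w. Re (cdot v (A *v w)))" for A :: "complex^'n^'n"
proof -
  have "linear ((*v) A)"
    by (rule linearI)
      (simp_all add: matrix_vector_mult_def vec_eq_iff distrib_left sum.distrib scaleR_sum_right)
  then have "bounded_linear ((*v) A)"
    by (rule linear_conv_bounded_linear[THEN iffD1])
  then show ?thesis
    unfolding Re_cdot_conv_inner
    by (rule bounded_bilinear.comp[OF bounded_bilinear_inner bounded_linear_ident])
qed

text \<open>
  Substituting $v = G w$ turns $v^H G^{-1} v$ into $w^H G w$.
\<close>

lemma wnorm_sq_nonneg:
  assumes "pos_def_hermitian G"
  shows "0 \<le> wnorm_sq G v"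
proof -
  define w where "w = matrix_inv G *v v"
  have "G ** matrix_inv G = mat 1"
    using someI_ex[OF pos_def_hermitian_invertible[OF assms, unfolded invertible_def]]
    by (simp add: matrix_inv_def)
  then have v: "v = G *v w"
    by (simp add: w_def matrix_vector_mul_assoc)
  have "wnorm_sq G v = Re (cdot w (G *v w))"
    unfolding wnorm_sq_def w_def[symmetric] by (subst v) (metis Re_cdot_conv_inner inner_commute)
  also have "\<dots> \<ge> 0"
    using assms by (cases "w = 0") (auto simp: pos_def_hermitian_def cdot_def less_imp_le)
  finally show ?thesis .
qed

lemma Re_cdot_matrix_linear_comb:
  fixes A B :: "complex^'n^'n"
  shows "Re (cdot v ((a *\<^sub>R A + b *\<^sub>R B) *v w)) = a * Re (cdot v (A *v w)) + b * Re (cdot v (B *v w))"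
proof -
  have "(a *\<^sub>R A + b *\<^sub>R B) *v w = a *\<^sub>R (A *v w) + b *\<^sub>R (B *v w)"
    by (simp add: matrix_vector_mult_def vec_eq_iff sum.distrib scaleR_sum_right distrib_right)
  then show ?thesis
    by (simp add: Re_cdot_conv_inner inner_add_right)
qed

lemma pos_def_hermitian_convex_comb:
  assumes "pos_def_hermitian A" "pos_def_hermitian B" "0 \<le> t" "t \<le> 1"
  shows "pos_def_hermitian ((1 - t) *\<^sub>R A + t *\<^sub>R B)"
proof -
  have "hermitian ((1 - t) *\<^sub>R A + t *\<^sub>R B)"
    using assms(1,2)
    by (simp add: pos_def_hermitian_def hermitian_def conj_transpose_def vec_eq_iff)
  moreover have "0 < Re (cdot v (((1 - t) *\<^sub>R A + t *\<^sub>R B) *v v))" if "v \<noteq> 0" for v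
  proof -
    have "0 < Re (cdot v (A *v v))" "0 < Re (cdot v (B *v v))"
      using assms(1,2) that by (auto simp: pos_def_hermitian_def)
    then show ?thesis
      unfolding Re_cdot_matrix_linear_comb using assms(3,4)
      by (cases "t = 0") (auto intro!: add_nonneg_pos)
  qed
  ultimately show ?thesis by (simp add: pos_def_hermitian_def)
qed

lemma pos_def_hermitian_mat_1: "pos_def_hermitian (mat 1)"
  by (auto simp: pos_def_hermitian_def hermitian_def conj_transpose_mat_1 Re_cdot_conv_inner)

lemma continuous_on_det:
  fixes f :: "'a::topological_space \<Rightarrow> complex^'n^'n"
  assumes "continuous_on S f"
  shows "continuous_on S (\<lambda>t. det (f t))"
  unfolding det_def by (intro continuous_intros assms)

text \<open>
  The segment from the identity to $A$ consists of positive definite Hermitian matrices. Along it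
  the determinant is real, continuous and nonzero, and it starts at 1, so it cannot change sign.
\<close>

lemma det_pos_def_hermitian_pos:
  assumes "pos_def_hermitian A"
  shows "0 < Re (det A)"
proof (rule ccontr)
  assume neg: "\<not> 0 < Re (det A)"
  define f where "f t = (1 - t) *\<^sub>R mat 1 + t *\<^sub>R A" for t :: real
  have "continuous_on {0..1} (\<lambda>t. Re (det (f t)))"
    unfolding f_def by (intro continuous_intros continuous_on_det)
  moreover have "Re (det (f 1)) \<le> 0" "0 \<le> Re (det (f 0))"
    using neg by (simp_all add: f_def det_I)
  ultimately obtain t where t: "0 \<le> t" "t \<le> 1" "Re (det (f t)) = 0"
    using IVT2'[of "\<lambda>t. Re (det (f t))" 1 0 0] by auto
  have "pos_def_hermitian (f t)"
    unfolding f_def using t assms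
    by (intro pos_def_hermitian_convex_comb pos_def_hermitian_mat_1)
  then have "det (f t) \<noteq> 0" "det (f t) = of_real (Re (det (f t)))"
    using pos_def_hermitian_invertible invertible_det_nz
    by (blast, intro det_hermitian_real) (simp add: pos_def_hermitian_def)
  then show False using t(3) by simp
qed

section \<open>Gaussians of a positive semidefinite form\<close>

text \<open>
  The classical discriminant argument. Since the form may be degenerate, the case of a vanishing
  \<open>B y y\<close>, where the polynomial in \<open>t\<close> is affine, is treated on its own.
\<close>

lemma psd_form_Cauchy_Schwarz:
  fixes B :: "'a::real_normed_vector \<Rightarrow> 'a \<Rightarrow> real"
  assumes "bounded_bilinear B" and sym: "\<And>x y. B x y = B y x" and nonneg: "\<And>x. 0 \<le> B x x"
  shows "(B x y)\<^sup>2 \<le> B x x * B y y"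
proof -
  interpret bounded_bilinear B by fact
  have q: "0 \<le> B x x - 2 * t * B x y + t\<^sup>2 * B y y" for t
    using nonneg[of "x - t *\<^sub>R y"] sym[of y x]
    by (simp add: diff_left diff_right scaleR_left scaleR_right power2_eq_square algebra_simps)
  show ?thesis
  proof (cases "B y y = 0")
    case True
    have "B x y = 0"
    proof (rule ccontr)
      assume "B x y \<noteq> 0"
      \<comment> \<open>The polynomial in \<open>q\<close> is now affine in \<open>t\<close>; this \<open>t\<close> makes its value \<open>-1\<close>.\<close>
      then show False using q[of "(B x x + 1) / (2 * B x y)"] True by (simp add: field_simps)
    qed
    then show ?thesis using True by simp
  next
    case False
    then have "0 < B y y" using nonneg[of y] by simp
    \<comment> \<open>The minimiser of the quadratic polynomial in \<open>q\<close>.\<close>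
    then show ?thesis using q[of "B x y / B y y"]
      by (simp add: field_simps power2_eq_square)
  qed
qed

lemma psd_form_triangle:
  fixes B :: "'a::real_normed_vector \<Rightarrow> 'a \<Rightarrow> real"
  assumes "bounded_bilinear B" and sym: "\<And>x y. B x y = B y x" and nonneg: "\<And>x. 0 \<le> B x x"
  shows "sqrt (B (x + y) (x + y)) \<le> sqrt (B x x) + sqrt (B y y)"
proof (rule real_le_lsqrt)
  interpret bounded_bilinear B by fact
  have "B x y \<le> sqrt (B x x) * sqrt (B y y)"
    using psd_form_Cauchy_Schwarz[OF assms, of x y] real_le_rsqrt by (simp flip: real_sqrt_mult)
  then show "B (x + y) (x + y) \<le> (sqrt (B x x) + sqrt (B y y))\<^sup>2"
    using nonneg sym[of y x] by (simp add: add_left add_right power2_sum)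
qed (use nonneg in auto)

text \<open>
  The mean value inequality, with $|t| \le 1 + t^2/2 \le \exp(t^2/2)$ bounding the slope.
\<close>

lemma exp_neg_half_square_lipschitz: "\<bar>exp (- (a\<^sup>2 / 2)) - exp (- (b\<^sup>2 / 2))\<bar> \<le> \<bar>a - b\<bar>" for a b :: real
proof -
  have "norm (exp (- (a\<^sup>2 / 2)) - exp (- (b\<^sup>2 / 2))) \<le> 1 * norm (a - b)"
  proof (rule field_differentiable_bound[of UNIV])
    fix t :: real
    show "((\<lambda>t. exp (- (t\<^sup>2 / 2))) has_field_derivative - t * exp (- (t\<^sup>2 / 2))) (at t within UNIV)"
      by (auto intro!: derivative_eq_intros)
    have "\<bar>t\<bar> \<le> 1 + t\<^sup>2 / 2"
      using zero_le_power2[of "\<bar>t\<bar> - 1"] by (simp add: power2_diff)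
    also have "\<dots> \<le> exp (t\<^sup>2 / 2)" by (rule exp_ge_add_one_self)
    finally show "norm (- t * exp (- (t\<^sup>2 / 2))) \<le> 1"
      by (simp add: abs_mult exp_minus field_simps)
  qed auto
  then show ?thesis by simp
qed

text \<open>
  A nonzero quadratic form is not Lipschitz, but it is the square of a seminorm that is; the Gaussian
  factors through this seminorm and a Lipschitz function on the real line.
\<close>

lemma gaussian_lipschitz:
  fixes B :: "'a::real_normed_vector \<Rightarrow> 'a \<Rightarrow> real"
  assumes B: "bounded_bilinear B" and sym: "\<And>x y. B x y = B y x" and nonneg: "\<And>x. 0 \<le> B x x"
  shows "\<exists>L\<ge>0. \<forall>x y. \<bar>exp (- (B x x / 2)) - exp (- (B y y / 2))\<bar> \<le> L * norm (x - y)"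
proof -
  interpret bounded_bilinear B by fact
  obtain C where C: "0 \<le> C" "\<And>x y. norm (B x y) \<le> norm x * norm y * C"
    using nonneg_bounded by blast
  have seminorm: "sqrt (B z z) \<le> sqrt C * norm z" for z
    using C(2)[of z z] real_sqrt_le_mono[of "B z z" "C * (norm z)\<^sup>2"]
    by (simp add: real_sqrt_mult power2_eq_square mult_ac)
  have le: "sqrt (B x x) - sqrt (B y y) \<le> sqrt C * norm (x - y)" for x y
    using psd_form_triangle[OF assms, of "x - y" y] seminorm[of "x - y"] by simp
  have "\<bar>exp (- (B x x / 2)) - exp (- (B y y / 2))\<bar> \<le> sqrt C * norm (x - y)" for x y
    using exp_neg_half_square_lipschitz[of "sqrt (B x x)" "sqrt (B y y)"]
      le[of x y] le[of y x] nonneg by (simp add: norm_minus_commute)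
  then show ?thesis using C(1) by (intro exI[of _ "sqrt C"]) auto
qed

lemma L2_set_diff_le: "\<bar>L2_set f A - L2_set g A\<bar> \<le> (\<Sum>i\<in>A. \<bar>f i - g i\<bar>)"
proof -
  have *: "L2_set f A - L2_set g A \<le> (\<Sum>i\<in>A. \<bar>f i - g i\<bar>)" for f g :: "'a \<Rightarrow> real"
    using L2_set_triangle_ineq[of "\<lambda>i. f i - g i" g A] L2_set_le_sum_abs[of "\<lambda>i. f i - g i" A]
    by simp
  show ?thesis
    using *[of f g] *[of g f] by (simp add: abs_le_iff abs_minus_commute)
qed

text \<open>
  The square root of a sum of nonnegative terms is the $\ell^2$ norm of their square roots, hence
  Lipschitz when the latter are. A mixture can come arbitrarily close to 0, near
  which the slope of the square root is unbounded, but the root of a single Gaussian is again a Gaussian, with half the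
  exponent.
  The constant does not depend on the centres \<open>u\<close>; this gives uniformity in the parameter
  when the centres are $F(m) + \zeta_k$.
\<close>

lemma sqrt_gaussian_mixture_lipschitz:
  fixes B :: "'k \<Rightarrow> 'a::real_normed_vector \<Rightarrow> 'a \<Rightarrow> real"
  assumes "finite I" and c: "\<And>k. k \<in> I \<Longrightarrow> 0 \<le> c k"
    and B: "\<And>k. k \<in> I \<Longrightarrow> bounded_bilinear (B k)"
    and sym: "\<And>k x y. k \<in> I \<Longrightarrow> B k x y = B k y x"
    and nonneg: "\<And>k x. k \<in> I \<Longrightarrow> 0 \<le> B k x x"
  shows "\<exists>L\<ge>0. \<forall>u x y.
    \<bar>sqrt (\<Sum>k\<in>I. c k * exp (- B k (x - u k) (x - u k)))
      - sqrt (\<Sum>k\<in>I. c k * exp (- B k (y - u k) (y - u k)))\<bar> \<le> L * dist x y"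
proof -
  have "\<forall>k\<in>I. \<exists>L\<ge>0. \<forall>x y. \<bar>exp (- (B k x x / 2)) - exp (- (B k y y / 2))\<bar> \<le> L * norm (x - y)"
    using gaussian_lipschitz B sym nonneg by blast
  then obtain L where L0: "\<And>k. k \<in> I \<Longrightarrow> 0 \<le> L k"
    and L: "\<And>k x y. k \<in> I \<Longrightarrow> \<bar>exp (- (B k x x / 2)) - exp (- (B k y y / 2))\<bar> \<le> L k * norm (x - y)"
    by metis
  define h where "h u x k = sqrt (c k) * exp (- (B k (x - u k) (x - u k) / 2))" for u x k
  have s: "sqrt (\<Sum>k\<in>I. c k * exp (- B k (x - u k) (x - u k))) = L2_set (h u x) I" for u x
    unfolding L2_set_def h_def
    by (intro arg_cong[of _ _ sqrt] sum.cong refl)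
      (simp add: power_mult_distrib c flip: exp_of_nat_mult)
  have hL: "\<bar>h u x k - h u y k\<bar> \<le> sqrt (c k) * L k * dist x y" if "k \<in> I" for u x y k
    using mult_left_mono[OF L[OF that, of "x - u k" "y - u k"], of "sqrt (c k)"] c[OF that]
    by (simp add: h_def dist_norm abs_mult mult.assoc flip: right_diff_distrib)
  have "\<bar>L2_set (h u x) I - L2_set (h u y) I\<bar> \<le> (\<Sum>k\<in>I. sqrt (c k) * L k) * dist x y" for u x y
    using order_trans[OF L2_set_diff_le sum_mono[OF hL]] by (simp add: sum_distrib_right)
  then show ?thesis
    unfolding s using c L0 by (intro exI[of _ "\<Sum>k\<in>I. sqrt (c k) * L k"]) (auto intro!: sum_nonneg)
qed

section \<open>Normalised densities and their Hellinger distance\<close>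

definition normalised_density :: "'a measure \<Rightarrow> ('a \<Rightarrow> real) \<Rightarrow> 'a measure" where
  "normalised_density M g = density M (\<lambda>x. ennreal (1 / (LINT y|M. g y) * g x))"

context prob_space
begin

lemma integral_pos:
  fixes g :: "'a \<Rightarrow> real"
  assumes "integrable M g" and "\<And>x. 0 < g x"
  shows "0 < (LINT x|M. g x)"
proof -
  have "(LINT x|M. g x) \<noteq> 0"
  proof
    assume "(LINT x|M. g x) = 0"
    then have "AE x in M. g x = 0"
      using integral_nonneg_eq_0_iff_AE[OF assms(1)] assms(2) by (simp add: less_imp_le)
    then have "AE x in M. False"
      by eventually_elim (metis assms(2) less_irrefl)
    then show False by simp
  qed
  moreover have "0 \<le> (LINT x|M. g x)"
    using assms(2) by (intro integral_nonneg_AE) (simp add: less_imp_le)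
  ultimately show ?thesis by simp
qed

lemma prob_space_normalised_density:
  assumes g: "integrable M g" and pos: "\<And>x. 0 < g x"
  shows "prob_space (normalised_density M g)"
proof (rule prob_spaceI)
  have Z: "0 < (LINT x|M. g x)" by (rule integral_pos[OF assms])
  have [measurable]: "g \<in> borel_measurable M" using g by simp
  have "emeasure (normalised_density M g) (space (normalised_density M g))
      = (\<integral>\<^sup>+ x. ennreal (1 / (LINT y|M. g y) * g x) \<partial>M)"
    by (simp add: normalised_density_def emeasure_density cong: nn_integral_cong)
  also have "\<dots> = ennreal (LINT x|M. 1 / (LINT y|M. g y) * g x)"
    using g Z pos by (intro nn_integral_eq_integral) (auto simp: less_imp_le)
  also have "\<dots> = 1" using Z by simp
  finally show "emeasure (normalised_density M g) (space (normalised_density M g)) = 1" .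
qed

lemma RN_deriv_normalised_density:
  assumes "integrable M g"
  shows "AE x in M. RN_deriv M (normalised_density M g) x = ennreal (1 / (LINT y|M. g y) * g x)"
proof -
  have [measurable]: "g \<in> borel_measurable M" using assms by simp
  have "AE x in M. ennreal (1 / (LINT y|M. g y) * g x) = RN_deriv M (normalised_density M g) x"
    by (intro RN_deriv_unique) (simp_all add: normalised_density_def)
  then show ?thesis by eventually_elim simp
qed

text \<open>
  Let $a$ and $b$ be the integrals of $f$ and $g$, and $I$ that of $\sqrt{f g}$. Twice the squared
  distance equals
  $2 - 2I/\sqrt{ab} = (2\sqrt{ab} - 2I)/\sqrt{ab} \le (a + b - 2I)/\sqrt{ab}$ by the inequality
  of arithmetic and geometric means, and $a + b - 2I = \int (\sqrt f - \sqrt g)^2$. Thus the two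
  different normalising constants never have to be compared with each other.
\<close>

lemma hellinger_dist_normalised_density_le:
  assumes f: "integrable M f" "\<And>x. 0 < f x" and g: "integrable M g" "\<And>x. 0 < g x"
    and lip: "\<And>x. \<bar>sqrt (f x) - sqrt (g x)\<bar> \<le> \<delta>"
    and z: "0 < z" "z \<le> (LINT x|M. f x)" "z \<le> (LINT x|M. g x)"
  shows "hellinger_dist M (normalised_density M f) (normalised_density M g) \<le> \<delta> / sqrt (2 * z)"
proof -
  define a where "a = (LINT x|M. f x)"
  define b where "b = (LINT x|M. g x)"
  have ab: "0 < a" "0 < b" "z \<le> a" "z \<le> b" using z by (auto simp: a_def b_def)
  have [measurable]: "f \<in> borel_measurable M" "g \<in> borel_measurable M" using f g by simp_all
  have \<delta>: "0 \<le> \<delta>" using lip[of undefined] by linarith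
  have fg: "integrable M (\<lambda>x. sqrt (f x) * sqrt (g x))"
  proof (rule Bochner_Integration.integrable_bound[of _ "\<lambda>x. f x + g x"])
    have "sqrt (f x) * sqrt (g x) \<le> f x + g x" for x
    proof -
      have "0 \<le> (sqrt (f x) - sqrt (g x))\<^sup>2 + f x + g x"
        using f(2)[of x] g(2)[of x] by (simp add: less_imp_le)
      then show ?thesis using f(2)[of x] g(2)[of x] by (simp add: power2_diff less_imp_le)
    qed
    then show "AE x in M. norm (sqrt (f x) * sqrt (g x)) \<le> norm (f x + g x)"
      using f(2) g(2) by (simp add: less_imp_le abs_mult)
  qed (use f g in auto)
  have exp2: "(sqrt (s * f x) - sqrt (t * g x))\<^sup>2
      = s * f x + t * g x - 2 * (sqrt s * sqrt t) * (sqrt (f x) * sqrt (g x))"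
    if "0 \<le> s" "0 \<le> t" for s t x
    using that f(2)[of x] g(2)[of x]
    by (simp add: power2_diff real_sqrt_mult less_imp_le algebra_simps)
  define I where "I = (LINT x|M. sqrt (f x) * sqrt (g x))"
  have "(LINT x|M. (sqrt (enn2real (RN_deriv M (normalised_density M f) x))
        - sqrt (enn2real (RN_deriv M (normalised_density M g) x)))\<^sup>2)
      = (LINT x|M. (sqrt (1 / a * f x) - sqrt (1 / b * g x))\<^sup>2)"
  proof (rule integral_cong_AE)
    show "AE x in M. (sqrt (enn2real (RN_deriv M (normalised_density M f) x))
          - sqrt (enn2real (RN_deriv M (normalised_density M g) x)))\<^sup>2
        = (sqrt (1 / a * f x) - sqrt (1 / b * g x))\<^sup>2"
      using RN_deriv_normalised_density[OF f(1)] RN_deriv_normalised_density[OF g(1)]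
    proof eventually_elim
      case (elim x)
      then show ?case
        using ab f(2)[of x] g(2)[of x] by (simp add: a_def b_def less_imp_le)
    qed
  qed measurable
  also have "\<dots> = 2 - 2 * I / (sqrt a * sqrt b)"
  proof -
    have "(LINT x|M. (sqrt (1 / a * f x) - sqrt (1 / b * g x))\<^sup>2)
        = (1 / a) * a + (1 / b) * b - 2 * (sqrt (1 / a) * sqrt (1 / b)) * I"
      using ab f(1) g(1) fg
      by (subst exp2) (simp_all add: a_def b_def I_def)
    then show ?thesis using ab by (simp add: real_sqrt_divide)
  qed
  also have "\<dots> \<le> \<delta>\<^sup>2 / z"
  proof -
    have "a + b - 2 * I = (LINT x|M. (sqrt (1 * f x) - sqrt (1 * g x))\<^sup>2)"
      using f(1) g(1) fg by (subst exp2) (simp_all add: a_def b_def I_def)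
    also have "\<dots> \<le> (LINT x|M. \<delta>\<^sup>2)"
    proof (rule integral_mono)
      show "integrable M (\<lambda>x. (sqrt (1 * f x) - sqrt (1 * g x))\<^sup>2)"
        using f(1) g(1) fg by (subst exp2) auto
      show "(sqrt (1 * f x) - sqrt (1 * g x))\<^sup>2 \<le> \<delta>\<^sup>2" for x
        using lip[of x] \<delta> by (simp add: abs_le_square_iff[symmetric])
    qed simp
    finally have d: "a + b - 2 * I \<le> \<delta>\<^sup>2" by (simp add: prob_space)
    have "0 \<le> (sqrt a - sqrt b)\<^sup>2" by simp
    then have "2 * (sqrt a * sqrt b) - 2 * I \<le> \<delta>\<^sup>2"
      using d ab by (simp add: power2_diff)
    then have "(2 * (sqrt a * sqrt b) - 2 * I) / (sqrt a * sqrt b) \<le> \<delta>\<^sup>2 / (sqrt a * sqrt b)"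
      using ab by (intro divide_right_mono) auto
    then have "2 - 2 * I / (sqrt a * sqrt b) \<le> \<delta>\<^sup>2 / (sqrt a * sqrt b)"
      using ab by (simp add: diff_divide_distrib)
    also have "\<dots> \<le> \<delta>\<^sup>2 / z"
    proof (rule divide_left_mono)
      show "z \<le> sqrt a * sqrt b"
        using mult_mono[of "sqrt z" "sqrt a" "sqrt z" "sqrt b"] ab z(1) by simp
    qed (use ab z in auto)
    finally show ?thesis .
  qed
  finally have "hellinger_dist M (normalised_density M f) (normalised_density M g)
      \<le> sqrt (1 / 2 * (\<delta>\<^sup>2 / z))"
    unfolding hellinger_dist_def by (intro real_sqrt_le_mono mult_left_mono) auto
  also have "\<dots> = \<delta> / sqrt (2 * z)"
    using \<delta> by (simp add: real_sqrt_divide real_sqrt_mult)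
  finally show ?thesis .
qed

text \<open>
  A bounded family whose square roots are uniformly Lipschitz is itself uniformly Lipschitz, by
  $s^2 - t^2 = (s + t)(s - t)$. Hence the normalising constant is continuous in the parameter, and
  being positive it has a positive minimum on a compact set, as the preceding bound demands.
\<close>

lemma hellinger_dist_normalised_density_locally_lipschitz:
  fixes g :: "'d::metric_space \<Rightarrow> 'a \<Rightarrow> real"
  assumes [measurable]: "\<And>d. g d \<in> borel_measurable M"
    and pos: "\<And>d x. 0 < g d x" and bd: "\<And>d x. g d x \<le> b"
    and lip: "\<And>d e x. \<bar>sqrt (g d x) - sqrt (g e x)\<bar> \<le> L * dist d e"
    and S: "compact S"
  shows "\<exists>C>0. \<forall>d\<in>S. \<forall>e\<in>S.
    hellinger_dist M (normalised_density M (g d)) (normalised_density M (g e)) \<le> C * dist d e"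
proof -
  have int: "integrable M (g d)" for d
    using pos bd by (intro integrable_const_bound[of _ b]) (simp_all add: less_imp_le)
  have glip: "\<bar>g d x - g e x\<bar> \<le> 2 * sqrt b * (L * dist d e)" for d e x
  proof -
    have "g d x - g e x = (sqrt (g d x) + sqrt (g e x)) * (sqrt (g d x) - sqrt (g e x))"
      using pos[of d x] pos[of e x] by (simp add: algebra_simps less_imp_le)
    then have "\<bar>g d x - g e x\<bar> = (sqrt (g d x) + sqrt (g e x)) * \<bar>sqrt (g d x) - sqrt (g e x)\<bar>"
      using pos[of d x] pos[of e x] by (simp add: abs_mult less_imp_le)
    also have "\<dots> \<le> (sqrt b + sqrt b) * (L * dist d e)"
      using pos[of d x] pos[of e x] bd[of d x] bd[of e x]
      by (intro mult_mono lip add_mono real_sqrt_le_mono) (auto simp: less_imp_le)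
    finally show ?thesis by simp
  qed
  have Zlip: "\<bar>(LINT x|M. g d x) - (LINT x|M. g e x)\<bar> \<le> 2 * sqrt b * L * dist d e" for d e
  proof -
    have "\<bar>(LINT x|M. g d x) - (LINT x|M. g e x)\<bar> \<le> (LINT x|M. \<bar>g d x - g e x\<bar>)"
      using integral_abs_bound[of M "\<lambda>x. g d x - g e x"] int by simp
    also have "\<dots> \<le> (LINT x|M. 2 * sqrt b * (L * dist d e))"
      using int glip by (intro integral_mono) auto
    finally show ?thesis by (simp add: prob_space mult.assoc)
  qed
  have "continuous_on S (\<lambda>d. LINT x|M. g d x)"
  proof (rule lipschitz_on_continuous_on)
    \<comment> \<open>On a one-point parameter space \<open>L\<close> may be negative, hence the absolute value.\<close>
    show "\<bar>2 * sqrt b * L\<bar>-lipschitz_on S (\<lambda>d. LINT x|M. g d x)"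
    proof (rule lipschitz_onI)
      show "dist (LINT x|M. g d x) (LINT x|M. g e x) \<le> \<bar>2 * sqrt b * L\<bar> * dist d e" for d e
        using order_trans[OF Zlip[of d e] mult_right_mono[OF abs_ge_self zero_le_dist]]
        by (simp add: dist_real_def)
    qed simp
  qed
  then have "\<exists>z>0. \<forall>d\<in>S. z \<le> (LINT x|M. g d x)"
  proof (cases "S = {}")
    case False
    assume "continuous_on S (\<lambda>d. LINT x|M. g d x)"
    from continuous_attains_inf[OF S False this] show ?thesis
      using integral_pos[OF int pos] by blast
  qed (auto intro: exI[of _ 1])
  then obtain z where z: "0 < z" "\<And>d. d \<in> S \<Longrightarrow> z \<le> (LINT x|M. g d x)" by blast
  have "hellinger_dist M (normalised_density M (g d)) (normalised_density M (g e))
      \<le> ((\<bar>L\<bar> + 1) / sqrt (2 * z)) * dist d e" if "d \<in> S" "e \<in> S" for d e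
  proof -
    have "L * dist d e \<le> (\<bar>L\<bar> + 1) * dist d e" by (intro mult_right_mono) auto
    then have "\<bar>sqrt (g d x) - sqrt (g e x)\<bar> \<le> (\<bar>L\<bar> + 1) * dist d e" for x
      using lip[of d x e] by linarith
    from hellinger_dist_normalised_density_le[OF int pos int pos this z(1) z(2)[OF that(1)] z(2)[OF that(2)]]
    show ?thesis by simp
  qed
  then show ?thesis using z(1) by (intro exI[of _ "(\<bar>L\<bar> + 1) / sqrt (2 * z)"]) auto
qed

end

section \<open>The Gaussian mixture posterior\<close>

theorem theorem2p1:
  fixes F :: "'x::{banach, second_countable_topology} \<Rightarrow> complex^'n"
    and \<mu>0 :: "'x measure"
    and \<nu> :: real and K :: nat
    and p :: "nat \<Rightarrow> real" and \<zeta> :: "nat \<Rightarrow> complex^'n" and \<Sigma> :: "nat \<Rightarrow> complex^'n^'n"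
  assumes "K > 0" and "\<nu> > 0"
    and "\<forall>k\<in>{1..K}. 0 < p k \<and> p k < 1" and "(\<Sum>k = 1..K. p k) = 1"
    and "\<forall>k\<in>{1..K}. pos_def_hermitian (\<Sigma> k)"
    and "\<forall>m. F differentiable (at m)"
    and "\<forall>\<epsilon>>0. \<exists>M C :: real. \<forall>m. norm (F m) \<le> C * exp (\<epsilon> * (norm m)\<^sup>2 + M)"
    and "\<forall>\<rho>>0. \<exists>K\<^sub>\<rho>>0. \<forall>m. norm m < \<rho> \<longrightarrow> onorm (frechet_derivative F (at m)) \<le> K\<^sub>\<rho>"
    and "sets \<mu>0 = sets borel" and "emeasure \<mu>0 UNIV = 1"
    and "\<exists>B\<in>sets \<mu>0. bounded B \<and> emeasure \<mu>0 B > 0"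
    and "\<exists>\<epsilon>>0. (\<integral>\<^sup>+ m. ennreal (exp (2 * \<epsilon> * (norm m)\<^sup>2)) \<partial>\<mu>0) < \<infinity>"
  shows "(\<forall>d. integrable \<mu>0 (\<lambda>m. exp (Phi \<nu> K p \<zeta> \<Sigma> F m d))
            \<and> 0 < Z \<mu>0 \<nu> K p \<zeta> \<Sigma> F d
            \<and> sets (posterior \<mu>0 \<nu> K p \<zeta> \<Sigma> F d) = sets borel
            \<and> prob_space (posterior \<mu>0 \<nu> K p \<zeta> \<Sigma> F d)
            \<and> absolutely_continuous \<mu>0 (posterior \<mu>0 \<nu> K p \<zeta> \<Sigma> F d)
            \<and> (AE m in \<mu>0. RN_deriv \<mu>0 (posterior \<mu>0 \<nu> K p \<zeta> \<Sigma> F d) m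
                 = ennreal (1 / Z \<mu>0 \<nu> K p \<zeta> \<Sigma> F d * exp (Phi \<nu> K p \<zeta> \<Sigma> F m d))))
       \<and> (\<forall>r>0. \<exists>C>0. \<forall>d1\<in>ball 0 r. \<forall>d2\<in>ball 0 r.
            hellinger_dist \<mu>0 (posterior \<mu>0 \<nu> K p \<zeta> \<Sigma> F d1) (posterior \<mu>0 \<nu> K p \<zeta> \<Sigma> F d2)
              \<le> C * norm (d1 - d2))"
proof -
  define G where "G k = \<Sigma> k + \<nu> *\<^sub>R mat 1" for k
  define c where "c k = p k * (1 / (pi ^ CARD('n) * Re (det (G k))))" for k
  define B where "B k v w = Re (cdot v (matrix_inv (G k) *v w))" for k v w
  define g where "g d m = (\<Sum>k = 1..K. c k * exp (- B k (d - (F m + \<zeta> k)) (d - (F m + \<zeta> k))))" for d m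
  have G: "pos_def_hermitian (G k)" if "k \<in> {1..K}" for k
    unfolding G_def using assms(2,5) that by (intro pos_def_hermitian_shift) auto
  have c: "0 < c k" if "k \<in> {1..K}" for k
    using det_pos_def_hermitian_pos[OF G[OF that]] assms(3) that by (simp add: c_def)
  have B: "bounded_bilinear (B k)" for k
    unfolding B_def by (rule bounded_bilinear_Re_cdot_matrix)
  have B_sym: "B k v w = B k w v" if "k \<in> {1..K}" for k v w
    unfolding B_def by (intro Re_cdot_matrix_commute hermitian_matrix_inv G that)
  have B_nonneg: "0 \<le> B k v v" if "k \<in> {1..K}" for k v
    using wnorm_sq_nonneg[OF G[OF that]] by (simp add: wnorm_sq_def B_def)
  have g_pos: "0 < g d m" for d m
    unfolding g_def using c assms(1) by (intro sum_pos) auto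
  have exp_Phi: "exp (Phi \<nu> K p \<zeta> \<Sigma> F m d) = g d m" for d m
  proof -
    have "Phi \<nu> K p \<zeta> \<Sigma> F m d = ln (g d m)"
      by (simp add: Phi_def g_def c_def B_def G_def wnorm_sq_def diff_diff_eq)
    then show ?thesis using g_pos by simp
  qed
  have post: "posterior \<mu>0 \<nu> K p \<zeta> \<Sigma> F d = normalised_density \<mu>0 (g d)" for d
    by (simp add: posterior_def normalised_density_def Z_def exp_Phi)
  have Z: "Z \<mu>0 \<nu> K p \<zeta> \<Sigma> F d = (LINT m|\<mu>0. g d m)" for d
    by (simp add: Z_def exp_Phi)
  have "space \<mu>0 = UNIV"
    using sets_eq_imp_space_eq[OF assms(9)] by simp
  then interpret prob_space \<mu>0
    using assms(10) by (intro prob_spaceI) simp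
  have g_meas [measurable]: "g d \<in> borel_measurable \<mu>0" for d
  proof -
    have "continuous_on UNIV F"
      using assms(6) by (simp add: continuous_on_eq_continuous_within differentiable_imp_continuous_within)
    then have "continuous_on UNIV (g d)"
      unfolding g_def by (intro continuous_intros bounded_bilinear.continuous_on[OF B])
    then show ?thesis
      using borel_measurable_continuous_onI measurable_cong_sets[OF assms(9) refl] by blast
  qed
  have g_le: "g d m \<le> (\<Sum>k = 1..K. c k)" for d m
    unfolding g_def
  proof (rule sum_mono)
    fix k assume k: "k \<in> {1..K}"
    show "c k * exp (- B k (d - (F m + \<zeta> k)) (d - (F m + \<zeta> k))) \<le> c k"
      using B_nonneg[OF k] c[OF k] by (intro mult_left_le) auto
  qed
  have int: "integrable \<mu>0 (g d)" for d
    using g_pos g_le by (intro integrable_const_bound[of _ "\<Sum>k = 1..K. c k"]) (simp_all add: less_imp_le)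
  have "\<exists>L\<ge>0. \<forall>u x y. \<bar>sqrt (\<Sum>k = 1..K. c k * exp (- B k (x - u k) (x - u k)))
      - sqrt (\<Sum>k = 1..K. c k * exp (- B k (y - u k) (y - u k)))\<bar> \<le> L * dist x y"
    using B B_sym B_nonneg c
    by (intro sqrt_gaussian_mixture_lipschitz) (auto simp: less_imp_le)
  then obtain L where "\<forall>u x y. \<bar>sqrt (\<Sum>k = 1..K. c k * exp (- B k (x - u k) (x - u k)))
      - sqrt (\<Sum>k = 1..K. c k * exp (- B k (y - u k) (y - u k)))\<bar> \<le> L * dist x y"
    by blast
  then have g_lip: "\<bar>sqrt (g d m) - sqrt (g e m)\<bar> \<le> L * dist d e" for d e m
    unfolding g_def by (elim allE)
  have "\<exists>C>0. \<forall>d1\<in>cball 0 r. \<forall>d2\<in>cball 0 r.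
      hellinger_dist \<mu>0 (normalised_density \<mu>0 (g d1)) (normalised_density \<mu>0 (g d2))
        \<le> C * dist d1 d2" for r
    by (rule hellinger_dist_normalised_density_locally_lipschitz
        [OF g_meas g_pos g_le g_lip compact_cball])
  then have "\<exists>C>0. \<forall>d1\<in>ball 0 r. \<forall>d2\<in>ball 0 r.
      hellinger_dist \<mu>0 (normalised_density \<mu>0 (g d1)) (normalised_density \<mu>0 (g d2))
        \<le> C * norm (d1 - d2)" for r
    unfolding dist_norm by (fast dest: subsetD[OF ball_subset_cball])
  then show ?thesis
    unfolding exp_Phi post Z
  proof (intro conjI allI impI)
    fix d
    show "integrable \<mu>0 (g d)" by (rule int)
    show "0 < (LINT m|\<mu>0. g d m)" by (rule integral_pos[OF int g_pos])
    show "sets (normalised_density \<mu>0 (g d)) = sets borel"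
      by (simp add: normalised_density_def assms(9))
    show "prob_space (normalised_density \<mu>0 (g d))"
      by (rule prob_space_normalised_density[OF int g_pos])
    show "absolutely_continuous \<mu>0 (normalised_density \<mu>0 (g d))"
      unfolding normalised_density_def by (rule absolutely_continuousI_density) measurable
    show "AE m in \<mu>0. RN_deriv \<mu>0 (normalised_density \<mu>0 (g d)) m
        = ennreal (1 / (LINT m|\<mu>0. g d m) * g d m)"
      by (rule RN_deriv_normalised_density[OF int])
  qed
qed

end
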